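(* Let $N\ge1$ and $G>0$. For each $U\in\mathcal A_N$ let $A_G(U)=A_L(U)+\Delta A(U)$ and $B_G(U)=B_L(U)+\Delta B(U)$ be the coefficient matrices of the $G$-SWLME. Then, for every unit direction $n=(\cos\theta,\sin\theta)^T$ and every $U\in\mathcal A_N$, the directional coefficient matrix $$A_n(U)=\cos\theta\,A_G(U)+\sin\theta\,B_G(U)$$ is real diagonalizable. Consequently, the two-dimensional $G$-SWLME is globally hyperbolic on $\mathcal A_N$.
   Context: State space: $\mathcal A_N=\{U\in\mathbb R^{2N+3}: h>0\}$, where $$U=(h,hu_m,hv_m,h\alpha_1,h\beta_1,\ldots,h\alpha_N,h\beta_N)^T,$$ so that $u_m,v_m,\alpha_j,\beta_j$ are the functions of $U$ obtained by dividing the corresponding component by $h$. SWLME matrices: $A_L(U)=\partial_UF_L(U)+P_1(U)$, $B_L(U)=\partial_UG_L(U)+Q_1(U)$ ($\partial_U$ is the Jacobian with respect to the components of $U$), where $$F_L(U)=\Big(hu_m,\;h\big(u_m^2+\sum_{j=1}^N\tfrac{\alpha_j^2}{2j+1}\big)+\tfrac12Gh^2,\;h\big(u_mv_m+\sum_{j=1}^N\tfrac{\alpha_j\beta_j}{2j+1}\big),\;2hu_m\alpha_1,\;h(u_m\beta_1+v_m\alpha_1),\ldots,2hu_m\alpha_N,\;h(u_m\beta_N+v_m\alpha_N)\Big)^T,$$ $$G_L(U)=\Big(hv_m,\;h\big(u_mv_m+\sum_{j=1}^N\tfrac{\alpha_j\beta_j}{2j+1}\big),\;h\big(v_m^2+\sum_{j=1}^N\tfrac{\beta_j^2}{2j+1}\big)+\tfrac12Gh^2,\;h(u_m\beta_1+v_m\alpha_1),\;2hv_m\beta_1,\ldots,h(u_m\beta_N+v_m\alpha_N),\;2hv_m\beta_N\Big)^T,$$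 and $P_1(U)=\mathrm{diag}(0_{3\times3},p(U),\ldots,p(U))$, $Q_1(U)=\mathrm{diag}(0_{3\times3},q(U),\ldots,q(U))$ (block diagonal, $N$ copies of the $2\times2$ block) with $$p(U)=\begin{pmatrix}-u_m&0\\-v_m&0\end{pmatrix},\qquad q(U)=\begin{pmatrix}0&-u_m\\0&-v_m\end{pmatrix}.$$ Corrections: index the horizontal vector pairs by $0,1,\ldots,N$, where pair $0$ is $(hu_m,hv_m)$ and pair $j\ge1$ is $(h\alpha_j,h\beta_j)$; $(M)_{kl}$ denotes the $2\times2$ block of $M$ with rows of pair $k$ and columns of pair $l$. The only nonzero entries of $\Delta A(U),\Delta B(U)\in\mathbb R^{(2N+3)\times(2N+3)}$ are in the blocks, for $j=1,\ldots,N$, $$(\Delta A)_{0j}=\frac1{2j+1}\begin{pmatrix}0&0\\-\beta_j&\alpha_j\end{pmatrix},\qquad(\Delta B)_{0j}=\frac1{2j+1}\begin{pmatrix}\beta_j&-\alpha_j\\0&0\end{pmatrix};$$ all other entries (including the first row and column, associated with $h$) vanish. The $G$-SWLME is the system with principal part $\partial_tU+A_G(U)\partial_xU+B_G(U)\partial_yU$. Global hyperbolicity on $\mathcal A_N$: for every $U\in\mathcal A_N$ and every unit vector $n=(\cos\theta,\sin\theta)^T$ the matrix $\cos\theta\,A_G(U)+\sin\theta\,B_G(U)$ is diagonalizable over $\mathbb R$. *)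

theory Defs
  imports "HOL-Analysis.Derivative" "Jordan_Normal_Form.Matrix"
begin

unbundle no vec_syntax

text \<open>
  A state \<open>U = (h, h u\<^sub>m, h v\<^sub>m, h \<alpha>\<^sub>1, h \<beta>\<^sub>1, \<dots>, h \<alpha>\<^sub>N, h \<beta>\<^sub>N)\<close> is a vector of dimension
  \<open>2 * N + 3\<close>, with indices starting at \<open>0\<close>. Pair \<open>j\<close> occupies the positions \<open>2 * j + 1\<close>
  and \<open>2 * j + 2\<close>; conversely a position \<open>i \<ge> 1\<close> belongs to pair \<open>(i - 1) div 2\<close>, and
  it is the first component of that pair iff \<open>i\<close> is odd.
\<close>

definition state_space :: "nat \<Rightarrow> real vec set" where
  "state_space N = {U \<in> carrier_vec (2 * N + 3). U $ 0 > 0}"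

definition height :: "real vec \<Rightarrow> real" where
  "height U = U $ 0"

definition um :: "real vec \<Rightarrow> real" where
  "um U = U $ 1 / height U"

definition vm :: "real vec \<Rightarrow> real" where
  "vm U = U $ 2 / height U"

definition alpha :: "real vec \<Rightarrow> nat \<Rightarrow> real" where
  "alpha U j = U $ (2 * j + 1) / height U"

definition beta :: "real vec \<Rightarrow> nat \<Rightarrow> real" where
  "beta U j = U $ (2 * j + 2) / height U"

definition pair_of :: "nat \<Rightarrow> nat" where
  "pair_of i = (i - 1) div 2"

definition F_L :: "nat \<Rightarrow> real \<Rightarrow> real vec \<Rightarrow> real vec" where
  "F_L N G U = vec (2 * N + 3) (\<lambda>i.
     let h = height U; u = um U; v = vm U; j = pair_of i in
       if i = 0 then h * u
       else if i = 1 then h * (u\<^sup>2 + (\<Sum>l = 1..N. (alpha U l)\<^sup>2 / (2 * real l + 1))) + G * h\<^sup>2 / 2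
       else if i = 2 then h * (u * v + (\<Sum>l = 1..N. alpha U l * beta U l / (2 * real l + 1)))
       else if odd i then 2 * h * u * alpha U j
       else h * (u * beta U j + v * alpha U j))"

definition G_L :: "nat \<Rightarrow> real \<Rightarrow> real vec \<Rightarrow> real vec" where
  "G_L N G U = vec (2 * N + 3) (\<lambda>i.
     let h = height U; u = um U; v = vm U; j = pair_of i in
       if i = 0 then h * v
       else if i = 1 then h * (u * v + (\<Sum>l = 1..N. alpha U l * beta U l / (2 * real l + 1)))
       else if i = 2 then h * (v\<^sup>2 + (\<Sum>l = 1..N. (beta U l)\<^sup>2 / (2 * real l + 1))) + G * h\<^sup>2 / 2
       else if odd i then h * (u * beta U j + v * alpha U j)
       else 2 * h * v * beta U j)"

definition jacobian :: "(real vec \<Rightarrow> real vec) \<Rightarrow> real vec \<Rightarrow> real mat" where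
  "jacobian F U = mat (dim_vec (F U)) (dim_vec U)
     (\<lambda>(i, k). deriv (\<lambda>t. F (U + t \<cdot>\<^sub>v unit_vec (dim_vec U) k) $ i) 0)"

text \<open>
  \<^const>\<open>deriv\<close> is an arbitrary value where no derivative exists; on \<^const>\<open>state_space\<close>
  all the partial derivatives below do exist.
\<close>

lemma partial_derivatives_exist:
  assumes "U \<in> state_space N" "i < 2 * N + 3" "k < 2 * N + 3"
  shows "(\<lambda>t. F_L N G (U + t \<cdot>\<^sub>v unit_vec (dim_vec U) k) $ i) field_differentiable at 0"
    and "(\<lambda>t. G_L N G (U + t \<cdot>\<^sub>v unit_vec (dim_vec U) k) $ i) field_differentiable at 0"
proof -
  define c where "c l = (unit_vec (dim_vec U) k $ l :: real)" for l
  have d: "dim_vec U = 2 * N + 3" "U $ 0 > 0" using assms(1) by (auto simp: state_space_def)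
  have ix: "(U + t \<cdot>\<^sub>v unit_vec (dim_vec U) k) $ l = U $ l + t * c l" if "l < 2 * N + 3" for t l
    using that d by (simp add: c_def)
  have lin: "(\<lambda>t. (U + t \<cdot>\<^sub>v unit_vec (dim_vec U) k) $ l) field_differentiable at 0" if "l < 2 * N + 3" for l
    unfolding ix[OF that] by (intro derivative_intros)
  have quot: "(\<lambda>t. (U + t \<cdot>\<^sub>v unit_vec (dim_vec U) k) $ l / (U + t \<cdot>\<^sub>v unit_vec (dim_vec U) k) $ 0) field_differentiable at 0" if "l < 2 * N + 3" for l
    using d by (intro field_differentiable_divide lin that) (auto simp: ix)
  let ?V = "\<lambda>t. U + t \<cdot>\<^sub>v unit_vec (dim_vec U) k"
  have h: "(\<lambda>t. height (?V t)) field_differentiable at 0" 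
    unfolding height_def by (intro lin) simp
  have u: "(\<lambda>t. um (?V t)) field_differentiable at 0" "(\<lambda>t. vm (?V t)) field_differentiable at 0"
    unfolding um_def vm_def height_def by (intro quot; simp)+
  have ab: "(\<lambda>t. alpha (?V t) l) field_differentiable at 0" "(\<lambda>t. beta (?V t) l) field_differentiable at 0" if "l \<le> N" for l
    unfolding alpha_def beta_def height_def using that by (intro quot; simp)+
  have j: "pair_of i \<le> N" using assms(2) by (auto simp: pair_of_def)
  have s: "(\<lambda>t. \<Sum>l = Suc 0..N. f t l / (2 * real l + 1)) field_differentiable at 0"
    if "\<And>l. l \<le> N \<Longrightarrow> (\<lambda>t. f t l) field_differentiable at 0" for f :: "real \<Rightarrow> nat \<Rightarrow> real"
    using that by (intro field_differentiable_sum field_differentiable_divide field_differentiable_const) auto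
  have sums:
    "(\<lambda>t. \<Sum>l = Suc 0..N. (alpha (?V t) l)\<^sup>2 / (2 * real l + 1)) field_differentiable at 0"
    "(\<lambda>t. \<Sum>l = Suc 0..N. (beta (?V t) l)\<^sup>2 / (2 * real l + 1)) field_differentiable at 0"
    "(\<lambda>t. \<Sum>l = Suc 0..N. alpha (?V t) l * beta (?V t) l / (2 * real l + 1)) field_differentiable at 0"
    by (intro s field_differentiable_power field_differentiable_mult ab; assumption)+
  note * = h u ab j sums field_differentiable_mult field_differentiable_add field_differentiable_power field_differentiable_const field_differentiable_divide
  show "(\<lambda>t. F_L N G (?V t) $ i) field_differentiable at 0" 
    unfolding F_L_def Let_def using assms(2) by (cases "i = 0"; cases "i = 1"; cases "i = 2"; cases "odd i"; simp; (intro *; simp)?)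
  show "(\<lambda>t. G_L N G (?V t) $ i) field_differentiable at 0" 
    unfolding G_L_def Let_def using assms(2) by (cases "i = 0"; cases "i = 1"; cases "i = 2"; cases "odd i"; simp; (intro *; simp)?)
qed

definition p_block :: "real vec \<Rightarrow> real mat" where
  "p_block U = mat_of_rows_list 2 [[- um U, 0], [- vm U, 0]]"

definition q_block :: "real vec \<Rightarrow> real mat" where
  "q_block U = mat_of_rows_list 2 [[0, - um U], [0, - vm U]]"

definition P_1 :: "nat \<Rightarrow> real vec \<Rightarrow> real mat" where
  "P_1 N U = diag_block_mat (0\<^sub>m 3 3 # replicate N (p_block U))"

definition Q_1 :: "nat \<Rightarrow> real vec \<Rightarrow> real mat" where
  "Q_1 N U = diag_block_mat (0\<^sub>m 3 3 # replicate N (q_block U))"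

definition A_L :: "nat \<Rightarrow> real \<Rightarrow> real vec \<Rightarrow> real mat" where
  "A_L N G U = jacobian (F_L N G) U + P_1 N U"

definition B_L :: "nat \<Rightarrow> real \<Rightarrow> real vec \<Rightarrow> real mat" where
  "B_L N G U = jacobian (G_L N G) U + Q_1 N U"

text \<open>
  The corrections are supported on the block row of pair \<open>0\<close> (positions \<open>1\<close>, \<open>2\<close>) and
  the columns of the pairs \<open>j \<ge> 1\<close>. Only the second row of these blocks is nonzero
  for \<open>\<Delta>A\<close>, and only the first one for \<open>\<Delta>B\<close>.
\<close>

definition Delta_A :: "nat \<Rightarrow> real vec \<Rightarrow> real mat" where
  "Delta_A N U = mat (2 * N + 3) (2 * N + 3) (\<lambda>(i, k).
     let j = pair_of k in
       if i = 2 \<and> k \<ge> 3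
       then (if odd k then - beta U j else alpha U j) / (2 * real j + 1)
       else 0)"

definition Delta_B :: "nat \<Rightarrow> real vec \<Rightarrow> real mat" where
  "Delta_B N U = mat (2 * N + 3) (2 * N + 3) (\<lambda>(i, k).
     let j = pair_of k in
       if i = 1 \<and> k \<ge> 3
       then (if odd k then beta U j else - alpha U j) / (2 * real j + 1)
       else 0)"

definition A_G :: "nat \<Rightarrow> real \<Rightarrow> real vec \<Rightarrow> real mat" where
  "A_G N G U = A_L N G U + Delta_A N U"

definition B_G :: "nat \<Rightarrow> real \<Rightarrow> real vec \<Rightarrow> real mat" where
  "B_G N G U = B_L N G U + Delta_B N U"

definition real_diagonalizable :: "real mat \<Rightarrow> bool" where
  "real_diagonalizable M \<longleftrightarrow> (\<exists>D. diagonal_mat D \<and> similar_mat M D)"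

text \<open>
  Global hyperbolicity on \<open>S\<close> of a system with principal part
  \<open>\<partial>\<^sub>t U + A(U) \<partial>\<^sub>x U + B(U) \<partial>\<^sub>y U\<close>.
\<close>

definition globally_hyperbolic_on :: "real vec set \<Rightarrow> (real vec \<Rightarrow> real mat) \<Rightarrow> (real vec \<Rightarrow> real mat) \<Rightarrow> bool" where
  "globally_hyperbolic_on S A B \<longleftrightarrow>
     (\<forall>U \<in> S. \<forall>\<theta>. real_diagonalizable (cos \<theta> \<cdot>\<^sub>m A U + sin \<theta> \<cdot>\<^sub>m B U))"

end

theory Submission
  imports Defs "Jordan_Normal_Form.DL_Rank"
begin

text \<open>
  Write \<open>V\<^sub>0 = (u\<^sub>m, v\<^sub>m)\<close>, \<open>V\<^sub>j = (\<alpha>\<^sub>j, \<beta>\<^sub>j)\<close>, and describe a vector \<open>x\<close> by \<open>x\<^sub>0\<close> and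
  \<open>y\<^sub>j = x\<^sub>j - x\<^sub>0 V\<^sub>j\<close>, where \<open>x\<^sub>j\<close> is its \<open>j\<close>-th pair. The correction replaces the term
  \<open>V\<^sub>j (n \<bullet> x\<^sub>j)\<close> in the momentum rows by \<open>(n \<bullet> V\<^sub>j) x\<^sub>j\<close>, and with \<open>a\<^sub>j = n \<bullet> V\<^sub>j\<close> the operator
  \<open>L = A\<^sub>n - a\<^sub>0\<close> becomes
  \<open>x\<^sub>0 \<mapsto> n \<bullet> y\<^sub>0\<close>, \<open>y\<^sub>j \<mapsto> a\<^sub>j y\<^sub>0\<close>, \<open>y\<^sub>0 \<mapsto> G h x\<^sub>0 n + (\<Sum>j. a\<^sub>j (2 y\<^sub>j + x\<^sub>0 V\<^sub>j) / (2 j + 1))\<close>.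
  On the range of \<open>L\<close> the components of all \<open>y\<^sub>j\<close> along \<open>n\<close> (across \<open>n\<close>) are the multiples
  \<open>a\<^sub>j\<close> of one number, so only four scalars remain. With \<open>S = (\<Sum>j. a\<^sub>j\<^sup>2 / (2 j + 1))\<close> one finds
  \<open>L (L\<^sup>2 - (G h + 3 S)) (L\<^sup>2 - 2 S) = 0\<close>, and \<open>L (L\<^sup>2 - G h) = 0\<close> if \<open>S = 0\<close>. As \<open>G h + 3 S > 2 S\<close>,
  these polynomials have distinct real roots, hence the eigenvectors span.
\<close>

section \<open>Diagonalizability from an annihilating product\<close>

text \<open>A maximal independent set \<open>B\<close> of eigenvectors spans everything that the
  eigenvectors span, so it is a basis. With its elements as the columns of \<open>P\<close>, the
  eigenvector equations read \<open>A * P = P * D\<close>, and full rank makes \<open>P\<close>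
  invertible.\<close>

lemma (in vec_space) eigenvectors_span_imp_similar_diagonal:
  assumes A: "A \<in> carrier_mat n n"
    and span: "carrier_vec n \<subseteq> span {x \<in> carrier_vec n. \<exists>\<mu>. A *\<^sub>v x = \<mu> \<cdot>\<^sub>v x}"
  shows "\<exists>D. diagonal_mat D \<and> similar_mat A D"
proof -
  let ?S = "{x \<in> carrier_vec n. \<exists>\<mu>. A *\<^sub>v x = \<mu> \<cdot>\<^sub>v x}"
  obtain B where B: "finite B" "maximal B (\<lambda>T. T \<subseteq> ?S \<and> lin_indpt T)"
  proof -
    have "lin_indpt {}" by (rule finite_lin_indpt2) auto
    moreover have "finite T \<and> card T \<le> dim" if "T \<subseteq> ?S \<and> lin_indpt T" for T
      using that li_le_dim[of T] by (auto intro: li_le_dim)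
    ultimately show thesis using maximal_exists[of "\<lambda>T. T \<subseteq> ?S \<and> lin_indpt T" dim "{}"] that by blast
  qed
  have BS: "B \<subseteq> ?S" and indpt: "lin_indpt B" using B(2) by (auto simp: maximal_def)
  have Bc: "B \<subseteq> carrier_vec n" using BS by auto
  have "?S \<subseteq> span B"
  proof
    fix s assume s: "s \<in> ?S"
    show "s \<in> span B"
    proof (rule ccontr)
      assume ns: "s \<notin> span B"
      then have "lin_indpt (insert s B)"
        using lin_dep_iff_in_span[of B s] Bc indpt s span_mem[OF Bc] by auto
      with B(2) s BS have "insert s B = B" unfolding maximal_def
        by (metis (no_types, lifting) insert_subset subset_insertI)
      with ns Bc show False using span_mem by blast
    qed
  qed
  then have "span ?S \<subseteq> span B"
    using Bc span_is_submodule span_is_subset by (metis (no_types, lifting) Collect_subset)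
  then have spanB: "span B = carrier_vec n" using span Bc span_closed by auto
  then have "basis B" using indpt Bc by (simp add: basis_def)
  then have cardB: "card B = n" using dim_basis[OF B(1)] dim_is_n by simp
  obtain bs where bs: "set bs = B" "distinct bs" using finite_distinct_list[OF B(1)] by auto
  then have len: "length bs = n" using cardB distinct_card by fastforce
  define P where "P = mat_of_cols n bs"
  have P: "P \<in> carrier_mat n n" unfolding P_def len[symmetric] by (rule mat_of_cols_carrier(1))
  have cols: "cols P = bs" unfolding P_def using bs Bc by simp
  have "rank P = n" using lin_indpt_full_rank[OF P] cols bs indpt by simp
  then have "det P \<noteq> 0" using det_rank_iff[OF P] by simp
  \<comment> \<open>The \<open>()\<close> only fills the extension slot of the ring record; being a
    unit in the matrix ring yields the two-sided inverse \<open>Q\<close>.\<close>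
  from det_non_zero_imp_unit[OF P this, of "()"] obtain Q where
    Q: "Q \<in> carrier_mat n n" "Q * P = 1\<^sub>m n" "P * Q = 1\<^sub>m n"
    by (auto simp: Units_def ring_mat_def)
  have "\<forall>i<n. \<exists>\<mu>. A *\<^sub>v bs ! i = \<mu> \<cdot>\<^sub>v bs ! i"
  proof (intro allI impI)
    fix i assume "i < n"
    then have "bs ! i \<in> ?S" using BS bs(1) len nth_mem by blast
    then show "\<exists>\<mu>. A *\<^sub>v bs ! i = \<mu> \<cdot>\<^sub>v bs ! i" by simp
  qed
  then obtain \<mu> where \<mu>: "\<And>i. i < n \<Longrightarrow> A *\<^sub>v bs ! i = \<mu> i \<cdot>\<^sub>v bs ! i" by metis
  define D where "D = mat n n (\<lambda>(i, j). if i = j then \<mu> i else 0)"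
  have D: "D \<in> carrier_mat n n" by (simp add: D_def)
  have AP: "A * P = P * D"
  proof (rule eq_matI)
    fix i j assume "i < dim_row (P * D)" "j < dim_col (P * D)"
    then have ij: "i < n" "j < n" using P D by auto
    have colP: "col P j = bs ! j" using cols cols_nth[of j P] P ij by auto
    have bj: "bs ! j \<in> carrier_vec n" using bs Bc len ij by auto
    have "(A * P) $$ (i, j) = (A *\<^sub>v bs ! j) $ i" using A P ij colP by simp
    also have "\<dots> = \<mu> j * (bs ! j) $ i" using \<mu>[OF ij(2)] bj ij by simp
    also have "(bs ! j) $ i = P $$ (i, j)" using colP P ij by (metis carrier_matD index_col)
    also have "\<mu> j * P $$ (i, j) = (\<Sum>k = 0..<n. P $$ (i, k) * D $$ (k, j))"
      using ij by (simp add: D_def if_distrib sum.delta' cong: if_cong)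
    also have "\<dots> = (P * D) $$ (i, j)" using P D ij by (simp add: scalar_prod_def)
    finally show "(A * P) $$ (i, j) = (P * D) $$ (i, j)" .
  qed (use A P D in auto)
  have "A = A * (P * Q)" using A Q by simp
  also have "\<dots> = P * D * Q" using A P Q AP by (metis assoc_mult_mat)
  finally have "similar_mat A D"
    by (intro similar_matI[of A D P Q n]) (use A D P Q in auto)
  moreover have "diagonal_mat D" by (simp add: D_def diagonal_mat_def)
  ultimately show ?thesis by blast
qed

text \<open>A listed value that is no eigenvalue contributes only the zero vector, so the list may
  hold any candidate roots. The recursion on the list follows that of \<open>fold\<close> in the
  annihilation hypothesis below.\<close>

primrec eigenspace_sum :: "'a :: field mat \<Rightarrow> 'a list \<Rightarrow> 'a vec set" where
  "eigenspace_sum A [] = {0\<^sub>v (dim_row A)}"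
| "eigenspace_sum A (\<mu> # \<mu>s) = {x + y | x y.
     x \<in> carrier_vec (dim_row A) \<and> A *\<^sub>v x = \<mu> \<cdot>\<^sub>v x \<and> y \<in> eigenspace_sum A \<mu>s}"

lemma eigenspace_sum_carrier:
  "x \<in> eigenspace_sum A \<mu>s \<Longrightarrow> x \<in> carrier_vec (dim_row A)"
  by (induction \<mu>s arbitrary: x) auto

lemma eigenspace_sum_ConsI:
  assumes "x \<in> carrier_vec (dim_row A)" "A *\<^sub>v x = \<mu> \<cdot>\<^sub>v x" "y \<in> eigenspace_sum A \<mu>s"
  shows "x + y \<in> eigenspace_sum A (\<mu> # \<mu>s)"
  using assms by auto

text \<open>On the summand for \<open>\<nu>\<close> the map \<open>A - \<mu>\<close> is
  multiplication by \<open>\<nu> - \<mu>\<close>, which is nonzero for every listed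
  \<open>\<nu>\<close>. Preimages are therefore found summand by summand.\<close>

lemma eigenspace_sum_shift_preimage:
  assumes A: "A \<in> carrier_mat n n" and "w \<in> eigenspace_sum A \<mu>s" "\<mu> \<notin> set \<mu>s"
  shows "\<exists>z \<in> eigenspace_sum A \<mu>s. A *\<^sub>v z - \<mu> \<cdot>\<^sub>v z = w"
  using assms(2,3)
proof (induction \<mu>s arbitrary: w)
  case Nil
  then show ?case using A by auto
next
  case (Cons \<nu> \<mu>s)
  then obtain x y where xy: "w = x + y" "x \<in> carrier_vec n" "A *\<^sub>v x = \<nu> \<cdot>\<^sub>v x" "y \<in> eigenspace_sum A \<mu>s"
    using A by auto
  with Cons obtain z where z: "z \<in> eigenspace_sum A \<mu>s" "A *\<^sub>v z - \<mu> \<cdot>\<^sub>v z = y" by auto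
  have zc: "z \<in> carrier_vec n" using eigenspace_sum_carrier[OF z(1)] A by simp
  obtain c where c: "c * (\<nu> - \<mu>) = 1"
  proof
    show "inverse (\<nu> - \<mu>) * (\<nu> - \<mu>) = 1" using Cons.prems(2) by (intro left_inverse) auto
  qed
  have "A *\<^sub>v (c \<cdot>\<^sub>v x) = \<nu> \<cdot>\<^sub>v (c \<cdot>\<^sub>v x)"
    using mult_mat_vec[OF A xy(2)] xy(3) by (simp add: smult_smult_assoc mult.commute)
  then have "c \<cdot>\<^sub>v x + z \<in> eigenspace_sum A (\<nu> # \<mu>s)"
    using xy(2) z(1) A by (intro eigenspace_sum_ConsI) auto
  moreover have "A *\<^sub>v (c \<cdot>\<^sub>v x + z) - \<mu> \<cdot>\<^sub>v (c \<cdot>\<^sub>v x + z) = w"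
  proof -
    have "A *\<^sub>v (c \<cdot>\<^sub>v x + z) = c \<cdot>\<^sub>v (\<nu> \<cdot>\<^sub>v x) + A *\<^sub>v z"
      using A xy zc by (simp add: mult_add_distrib_mat_vec[of _ n n] mult_mat_vec[of _ n n])
    then have "A *\<^sub>v (c \<cdot>\<^sub>v x + z) - \<mu> \<cdot>\<^sub>v (c \<cdot>\<^sub>v x + z)
        = (c * (\<nu> - \<mu>)) \<cdot>\<^sub>v x + (A *\<^sub>v z - \<mu> \<cdot>\<^sub>v z)"
      using xy(2) zc A by (intro eq_vecI) (auto simp: algebra_simps simp del: index_mult_mat_vec)
    then show ?thesis using c xy z by simp
  qed
  ultimately show ?case by blast
qed

text \<open>Induction on the list: \<open>(A - \<mu>) v\<close> lies in the sum for the remaining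
  values, where by distinctness it has a preimage \<open>z\<close> under \<open>A - \<mu>\<close>.
  Then \<open>v - z\<close> is in the kernel of \<open>A - \<mu>\<close>, and
  \<open>v = (v - z) + z\<close>.\<close>

lemma annihilated_in_eigenspace_sum:
  assumes A: "A \<in> carrier_mat n n" and "v \<in> carrier_vec n" "distinct \<mu>s"
    and "fold (\<lambda>\<mu> w. A *\<^sub>v w - \<mu> \<cdot>\<^sub>v w) \<mu>s v = 0\<^sub>v n"
  shows "v \<in> eigenspace_sum A \<mu>s"
  using assms(2-)
proof (induction \<mu>s arbitrary: v)
  case Nil
  then show ?case using A by auto
next
  case (Cons \<mu> \<mu>s)
  then have "A *\<^sub>v v - \<mu> \<cdot>\<^sub>v v \<in> eigenspace_sum A \<mu>s" using A by auto
  with Cons(3) obtain z where z: "z \<in> eigenspace_sum A \<mu>s" "A *\<^sub>v z - \<mu> \<cdot>\<^sub>v z = A *\<^sub>v v - \<mu> \<cdot>\<^sub>v v"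
    using eigenspace_sum_shift_preimage[OF A] by force
  have zc: "z \<in> carrier_vec n" using eigenspace_sum_carrier[OF z(1)] A by simp
  have "A *\<^sub>v (v - z) = \<mu> \<cdot>\<^sub>v (v - z)"
  proof (rule eq_vecI)
    fix i assume "i < dim_vec (\<mu> \<cdot>\<^sub>v (v - z))"
    then have i: "i < n" using zc by simp
    have "(A *\<^sub>v z - \<mu> \<cdot>\<^sub>v z) $ i = (A *\<^sub>v v - \<mu> \<cdot>\<^sub>v v) $ i" using z(2) by simp
    then have "(A *\<^sub>v z) $ i - \<mu> * z $ i = (A *\<^sub>v v) $ i - \<mu> * v $ i"
      using i zc Cons(2) by (auto simp del: index_mult_mat_vec)
    then have "(A *\<^sub>v v) $ i - (A *\<^sub>v z) $ i = \<mu> * (v $ i - z $ i)"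
      by (simp add: algebra_simps del: index_mult_mat_vec)
    moreover have "(A *\<^sub>v (v - z)) $ i = (A *\<^sub>v v) $ i - (A *\<^sub>v z) $ i"
      using i zc Cons(2) A by (simp add: mult_minus_distrib_mat_vec[of _ n n] del: index_mult_mat_vec)
    ultimately show "(A *\<^sub>v (v - z)) $ i = (\<mu> \<cdot>\<^sub>v (v - z)) $ i"
      using i zc Cons(2) by (simp del: index_mult_mat_vec)
  qed (use A zc in auto)
  moreover have "v = (v - z) + z" using zc Cons(2) by (intro eq_vecI) auto
  ultimately show ?case
    using eigenspace_sum_ConsI[of "v - z" A \<mu> z \<mu>s] z(1) zc A Cons(2) by simp
qed

lemma (in vec_space) eigenspace_sum_subset_span:
  assumes A: "A \<in> carrier_mat n n"
  shows "eigenspace_sum A \<mu>s \<subseteq> span {x \<in> carrier_vec n. \<exists>\<mu>. A *\<^sub>v x = \<mu> \<cdot>\<^sub>v x}" (is "_ \<subseteq> span ?S")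
proof (induction \<mu>s)
  case Nil
  have "0\<^sub>v n \<in> ?S" using A by (auto intro: exI[of _ 0])
  then show ?case using A span_mem[of ?S] by auto
next
  case (Cons \<mu> \<mu>s)
  show ?case
  proof
    fix w assume "w \<in> eigenspace_sum A (\<mu> # \<mu>s)"
    then obtain x y where xy: "w = x + y" "x \<in> ?S" "y \<in> span ?S"
      using A Cons by fastforce
    moreover have "x \<in> span ?S" using xy(2) by (intro span_mem) auto
    ultimately show "w \<in> span ?S" using span_add1[of ?S x y] by blast
  qed
qed

text \<open>The criterion that a matrix annihilated by a polynomial with distinct real roots is
  diagonalizable. The product is a \<open>fold\<close> of vector maps, so that the effect of each
  factor can be followed on a single vector.\<close>

lemma real_diagonalizableI:
  fixes A :: "real mat"
  assumes "A \<in> carrier_mat n n" "distinct \<mu>s"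
    and "\<And>v. v \<in> carrier_vec n \<Longrightarrow> fold (\<lambda>\<mu> w. A *\<^sub>v w - \<mu> \<cdot>\<^sub>v w) \<mu>s v = 0\<^sub>v n"
  shows "real_diagonalizable A"
  unfolding real_diagonalizable_def
  using assms annihilated_in_eigenspace_sum vec_space.eigenspace_sum_subset_span
  by (intro vec_space.eigenvectors_span_imp_similar_diagonal[of _ n]) blast+

section \<open>The Jacobians\<close>

text \<open>A common index for all primitive variables: every quadratic flux term becomes
  \<open>h\<close> times a product of two values of \<open>coord\<close>, and one derivative formula
  covers them all.\<close>

definition coord :: "real vec \<Rightarrow> nat \<Rightarrow> real" where
  "coord U p = U $ p / U $ 0"

lemma coord_eqs:
  "um U = coord U 1" "vm U = coord U 2" "alpha U j = coord U (2 * j + 1)" "beta U j = coord U (2 * j + 2)"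
  by (simp_all add: um_def vm_def alpha_def beta_def coord_def height_def)

text \<open>The differential at \<open>U\<close>, in direction \<open>w\<close>, of the product of \<open>h\<close> and the primitive variables \<open>p, q\<close>.\<close>

definition flux_deriv :: "real vec \<Rightarrow> real vec \<Rightarrow> nat \<Rightarrow> nat \<Rightarrow> real" where
  "flux_deriv U w p q = coord U p * w $ q + coord U q * w $ p - coord U p * coord U q * w $ 0"

text \<open>Near \<open>t = 0\<close> the height is positive and the function equals the product of
  components \<open>p\<close> and \<open>q\<close> divided by component \<open>0\<close>; the
  quotient rule applies.\<close>

lemma has_derivative_momentum_flux:
  assumes U: "U \<in> state_space N" and w: "w \<in> carrier_vec (2 * N + 3)" and pq: "p < 2 * N + 3" "q < 2 * N + 3"
  shows "((\<lambda>t. height (U + t \<cdot>\<^sub>v w) * (coord (U + t \<cdot>\<^sub>v w) p * coord (U + t \<cdot>\<^sub>v w) q))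
    has_real_derivative flux_deriv U w p q) (at 0)"
proof -
  have d: "dim_vec U = 2 * N + 3" "dim_vec w = 2 * N + 3" "U $ 0 > 0" using U w by (auto simp: state_space_def)
  have ix: "(U + t \<cdot>\<^sub>v w) $ l = U $ l + t * w $ l" if "l < 2 * N + 3" for t l
    using that d by simp
  show ?thesis
    unfolding height_def coord_def flux_deriv_def using d(3) pq
    by (auto simp: ix field_simps intro!: derivative_eq_intros)
qed

lemma has_derivative_momentum:
  assumes U: "U \<in> state_space N" and w: "w \<in> carrier_vec (2 * N + 3)" and p: "p < 2 * N + 3"
  shows "((\<lambda>t. height (U + t \<cdot>\<^sub>v w) * coord (U + t \<cdot>\<^sub>v w) p) has_real_derivative w $ p) (at 0)"
proof -
  have d: "dim_vec U = 2 * N + 3" "dim_vec w = 2 * N + 3" "U $ 0 > 0" using U w by (auto simp: state_space_def)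
  have ix: "(U + t \<cdot>\<^sub>v w) $ l = U $ l + t * w $ l" if "l < 2 * N + 3" for t l
    using that d by simp
  show ?thesis
    unfolding height_def coord_def using d(3) p
    by (auto simp: ix field_simps intro!: derivative_eq_intros)
qed

lemma has_derivative_pressure:
  assumes U: "U \<in> state_space N" and w: "w \<in> carrier_vec (2 * N + 3)"
  shows "((\<lambda>t. G * (height (U + t \<cdot>\<^sub>v w))\<^sup>2 / 2) has_real_derivative G * height U * w $ 0) (at 0)"
proof -
  have "dim_vec U = 2 * N + 3" "dim_vec w = 2 * N + 3" using U w by (auto simp: state_space_def)
  then show ?thesis
    unfolding height_def by (auto intro!: derivative_eq_intros)
qed

text \<open>The derivative of row \<open>i\<close> of \<open>F_L\<close> in direction
  \<open>w\<close>. As a linear form in \<open>w\<close> it serves twice: at unit vectors it gives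
  the Jacobian entries, at a general vector the Jacobian applied to it.\<close>

definition F_deriv :: "nat \<Rightarrow> real \<Rightarrow> real vec \<Rightarrow> real vec \<Rightarrow> nat \<Rightarrow> real" where
  "F_deriv N G U w i = (let j = pair_of i in
     if i = 0 then w $ 1
     else if i = 1 then flux_deriv U w 1 1
       + (\<Sum>l = 1..N. flux_deriv U w (2 * l + 1) (2 * l + 1) / (2 * real l + 1)) + G * height U * w $ 0
     else if i = 2 then flux_deriv U w 1 2
       + (\<Sum>l = 1..N. flux_deriv U w (2 * l + 1) (2 * l + 2) / (2 * real l + 1))
     else if odd i then 2 * flux_deriv U w 1 (2 * j + 1)
     else flux_deriv U w 1 (2 * j + 2) + flux_deriv U w 2 (2 * j + 1))"

definition G_deriv :: "nat \<Rightarrow> real \<Rightarrow> real vec \<Rightarrow> real vec \<Rightarrow> nat \<Rightarrow> real" where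
  "G_deriv N G U w i = (let j = pair_of i in
     if i = 0 then w $ 2
     else if i = 1 then flux_deriv U w 1 2
       + (\<Sum>l = 1..N. flux_deriv U w (2 * l + 1) (2 * l + 2) / (2 * real l + 1))
     else if i = 2 then flux_deriv U w 2 2
       + (\<Sum>l = 1..N. flux_deriv U w (2 * l + 2) (2 * l + 2) / (2 * real l + 1)) + G * height U * w $ 0
     else if odd i then flux_deriv U w 1 (2 * j + 2) + flux_deriv U w 2 (2 * j + 1)
     else 2 * flux_deriv U w 2 (2 * j + 2))"

text \<open>Distributes \<open>h\<close> over the sums, so that each term has the shape
  differentiated in \<open>has_derivative_momentum_flux\<close>.\<close>

lemma F_L_index:
  assumes "i < 2 * N + 3"
  shows "F_L N G V $ i = (let j = pair_of i; f = \<lambda>p q. height V * (coord V p * coord V q) in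
     if i = 0 then height V * coord V 1
     else if i = 1 then f 1 1 + (\<Sum>l = 1..N. f (2 * l + 1) (2 * l + 1) / (2 * real l + 1)) + G * (height V)\<^sup>2 / 2
     else if i = 2 then f 1 2 + (\<Sum>l = 1..N. f (2 * l + 1) (2 * l + 2) / (2 * real l + 1))
     else if odd i then 2 * f 1 (2 * j + 1)
     else f 1 (2 * j + 2) + f 2 (2 * j + 1))"
  using assms by (simp add: F_L_def coord_eqs Let_def power2_eq_square distrib_left sum_distrib_left)

lemma G_L_index:
  assumes "i < 2 * N + 3"
  shows "G_L N G V $ i = (let j = pair_of i; f = \<lambda>p q. height V * (coord V p * coord V q) in
     if i = 0 then height V * coord V 2
     else if i = 1 then f 1 2 + (\<Sum>l = 1..N. f (2 * l + 1) (2 * l + 2) / (2 * real l + 1))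
     else if i = 2 then f 2 2 + (\<Sum>l = 1..N. f (2 * l + 2) (2 * l + 2) / (2 * real l + 1)) + G * (height V)\<^sup>2 / 2
     else if odd i then f 1 (2 * j + 2) + f 2 (2 * j + 1)
     else 2 * f 2 (2 * j + 2))"
  using assms by (simp add: G_L_def coord_eqs Let_def power2_eq_square distrib_left sum_distrib_left)

lemma pair_of_less: "i < 2 * N + 3 \<Longrightarrow> 2 * pair_of i + 1 < 2 * N + 3" "i < 2 * N + 3 \<Longrightarrow> 2 * pair_of i + 2 < 2 * N + 3"
  unfolding pair_of_def by presburger+

lemma has_derivative_F_L:
  assumes U: "U \<in> state_space N" and w: "w \<in> carrier_vec (2 * N + 3)" and i: "i < 2 * N + 3"
  shows "((\<lambda>t. F_L N G (U + t \<cdot>\<^sub>v w) $ i) has_real_derivative F_deriv N G U w i) (at 0)"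
  unfolding F_L_index[OF i] F_deriv_def Let_def
  using pair_of_less[OF i]
  by (auto intro!: DERIV_add DERIV_sum DERIV_cdivide DERIV_cmult has_derivative_momentum_flux[OF U w]
      has_derivative_momentum[OF U w] has_derivative_pressure[OF U w] simp del: One_nat_def)

lemma has_derivative_G_L:
  assumes U: "U \<in> state_space N" and w: "w \<in> carrier_vec (2 * N + 3)" and i: "i < 2 * N + 3"
  shows "((\<lambda>t. G_L N G (U + t \<cdot>\<^sub>v w) $ i) has_real_derivative G_deriv N G U w i) (at 0)"
  unfolding G_L_index[OF i] G_deriv_def Let_def
  using pair_of_less[OF i]
  by (auto intro!: DERIV_add DERIV_sum DERIV_cdivide DERIV_cmult has_derivative_momentum_flux[OF U w]
      has_derivative_momentum[OF U w] has_derivative_pressure[OF U w] simp del: One_nat_def)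

lemma jacobian_index:
  assumes U: "U \<in> state_space N" and i: "i < 2 * N + 3" and k: "k < 2 * N + 3"
  shows "jacobian (F_L N G) U $$ (i, k) = F_deriv N G U (unit_vec (2 * N + 3) k) i"
    and "jacobian (G_L N G) U $$ (i, k) = G_deriv N G U (unit_vec (2 * N + 3) k) i"
proof -
  have d: "dim_vec U = 2 * N + 3" using U by (auto simp: state_space_def)
  show "jacobian (F_L N G) U $$ (i, k) = F_deriv N G U (unit_vec (2 * N + 3) k) i"
    using DERIV_imp_deriv[OF has_derivative_F_L[OF U _ i, of "unit_vec (2 * N + 3) k" G]] i k
    by (simp add: jacobian_def d F_L_def)
  show "jacobian (G_L N G) U $$ (i, k) = G_deriv N G U (unit_vec (2 * N + 3) k) i"
    using DERIV_imp_deriv[OF has_derivative_G_L[OF U _ i, of "unit_vec (2 * N + 3) k" G]] i k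
    by (simp add: jacobian_def d G_L_def)
qed

section \<open>Entries of block diagonal matrices with repeated blocks\<close>

lemma dim_diag_block_replicate:
  assumes "B \<in> carrier_mat m m"
  shows "dim_row (diag_block_mat (replicate N B)) = N * m" "dim_col (diag_block_mat (replicate N B)) = N * m"
  using assms by (simp_all add: dim_diag_block_mat sum_list_replicate)

text \<open>Induction on \<open>N\<close>, peeling off the leading block: this lowers both indices
  by 2, hence both block numbers by 1, and keeps the offsets inside the block.\<close>

lemma diag_block_replicate_index:
  assumes B: "B \<in> carrier_mat 2 2" and "i < 2 * N" "k < 2 * N"
  shows "diag_block_mat (replicate N B) $$ (i, k)
      = (if i div 2 = k div 2 then B $$ (i mod 2, k mod 2) else 0)"
  using assms(2,3)
proof (induction N arbitrary: i k)
  case (Suc N)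
  have *: "m div 2 = Suc ((m - 2) div 2)" "m mod 2 = (m - 2) mod 2" if "\<not> m < 2" for m :: nat
    using that by presburger+
  have eq: "diag_block_mat (replicate (Suc N) B) $$ (i, k) =
    (if i < 2 then if k < 2 then B $$ (i, k) else 0
     else if k < 2 then 0 else diag_block_mat (replicate N B) $$ (i - 2, k - 2))"
    using Suc.prems B dim_diag_block_replicate[OF B, of N] by (simp add: Let_def)
  consider "i < 2" "k < 2" | "i < 2" "\<not> k < 2" | "\<not> i < 2" "k < 2" | "\<not> i < 2" "\<not> k < 2" by blast
  then show ?case
  proof cases
    case 4
    then have "i - 2 < 2 * N" "k - 2 < 2 * N" using Suc.prems by auto
    from Suc.IH[OF this] 4 show ?thesis unfolding eq *(1,2)[OF 4(1)] *(1,2)[OF 4(2)] by simp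
  qed (simp_all only: eq, simp_all add: *(1))
qed simp

section \<open>The rows of the coefficient matrices as linear forms\<close>

lemma p_q_block_carrier: "p_block U \<in> carrier_mat 2 2" "q_block U \<in> carrier_mat 2 2"
  by (rule carrier_matI; simp add: p_block_def q_block_def mat_of_rows_list_def)+

lemma P_1_Q_1_carrier:
  "P_1 N U \<in> carrier_mat (2 * N + 3) (2 * N + 3)" "Q_1 N U \<in> carrier_mat (2 * N + 3) (2 * N + 3)"
  unfolding P_1_def Q_1_def diag_block_mat.simps Let_def carrier_mat_def
  using dim_diag_block_replicate[OF p_q_block_carrier(1)[of U], of N]
    dim_diag_block_replicate[OF p_q_block_carrier(2)[of U], of N] by simp_all

lemma diag_block_zero_replicate_index:
  assumes B: "B \<in> carrier_mat 2 2" and "i < 2 * N + 3" "k < 2 * N + 3"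
  shows "diag_block_mat (0\<^sub>m 3 3 # replicate N B) $$ (i, k)
    = (if 3 \<le> i \<and> 3 \<le> k \<and> pair_of i = pair_of k then B $$ ((i + 1) mod 2, (k + 1) mod 2) else 0)"
proof -
  \<comment> \<open>Behind the zero block of size 3, block number 0 belongs to pair 1, and odd
    positions, the first components, have offset 0.\<close>
  have p: "(m - 3) div 2 = pair_of m - 1" "pair_of m \<ge> 1" "(m - 3) mod 2 = (m + 1) mod 2" if "3 \<le> m" for m
  proof -
    define l where "l = m - 3"
    have m: "m = l + 3" using that by (simp add: l_def)
    have "pair_of m = l div 2 + 1" by (simp add: m pair_of_def)
    then show "(m - 3) div 2 = pair_of m - 1" "pair_of m \<ge> 1" by (simp_all add: l_def)
    show "(m - 3) mod 2 = (m + 1) mod 2"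
      using mod_mult_self2[of l 2 2] by (simp add: m add.commute)
  qed
  let ?D = "diag_block_mat (replicate N B)"
  have D: "dim_row ?D = 2 * N" "dim_col ?D = 2 * N"
    by (simp_all only: dim_diag_block_replicate[OF B] mult.commute)
  have eq: "diag_block_mat (0\<^sub>m 3 3 # replicate N B) $$ (i, k) =
      (if i < 3 \<or> k < 3 then 0 else ?D $$ (i - 3, k - 3))"
    using assms(2,3) D by (simp add: Let_def)
  show ?thesis
  proof (cases "i < 3 \<or> k < 3")
    case True
    then show ?thesis unfolding eq by auto
  next
    case False
    then have ik: "3 \<le> i" "3 \<le> k" by simp_all
    then have lt: "i - 3 < 2 * N" "k - 3 < 2 * N" using assms(2,3) by simp_all
    \<comment> \<open>Both pair numbers are at least 1, so the truncated subtraction is injective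
      here.\<close>
    have "(pair_of i - 1 = pair_of k - 1) = (pair_of i = pair_of k)"
      using p(2)[OF ik(1)] p(2)[OF ik(2)] by linarith
    then show ?thesis
      unfolding eq diag_block_replicate_index[OF B lt] p(1,3)[OF ik(1)] p(1,3)[OF ik(2)] using False by simp
  qed
qed

section \<open>Linear forms determined by their values on unit vectors\<close>

definition vec_linear :: "nat \<Rightarrow> (real vec \<Rightarrow> real) \<Rightarrow> bool" where
  "vec_linear n f \<longleftrightarrow> (\<forall>x \<in> carrier_vec n. (\<Sum>k = 0..<n. f (unit_vec n k) * x $ k) = f x)"

lemma vec_linear_intros:
  "p < n \<Longrightarrow> vec_linear n (\<lambda>w. w $ p)"
  "\<lbrakk>vec_linear n f; vec_linear n g\<rbrakk> \<Longrightarrow> vec_linear n (\<lambda>w. f w + g w)"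
  "\<lbrakk>vec_linear n f; vec_linear n g\<rbrakk> \<Longrightarrow> vec_linear n (\<lambda>w. f w - g w)"
  "vec_linear n f \<Longrightarrow> vec_linear n (\<lambda>w. c * f w)"
  "vec_linear n f \<Longrightarrow> vec_linear n (\<lambda>w. f w / c)"
  "\<lbrakk>\<And>l. l \<in> I \<Longrightarrow> vec_linear n (h l)\<rbrakk> \<Longrightarrow> vec_linear n (\<lambda>w. \<Sum>l \<in> I. h l w)"
proof -
  show "p < n \<Longrightarrow> vec_linear n (\<lambda>w. w $ p)"
    by (auto simp: vec_linear_def unit_vec_def if_distrib[of "\<lambda>a. a * _"] cong: if_cong)
  show "vec_linear n (\<lambda>w. \<Sum>l \<in> I. h l w)" if h: "\<And>l. l \<in> I \<Longrightarrow> vec_linear n (h l)"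
    unfolding vec_linear_def
  proof
    fix x :: "real vec" assume x: "x \<in> carrier_vec n"
    have "(\<Sum>k = 0..<n. (\<Sum>l\<in>I. h l (unit_vec n k)) * x $ k) = (\<Sum>l\<in>I. \<Sum>k = 0..<n. h l (unit_vec n k) * x $ k)"
      by (subst sum.swap) (simp add: sum_distrib_right)
    also have "\<dots> = (\<Sum>l\<in>I. h l x)" using h x by (intro sum.cong) (auto simp: vec_linear_def)
    finally show "(\<Sum>k = 0..<n. (\<Sum>l\<in>I. h l (unit_vec n k)) * x $ k) = (\<Sum>l\<in>I. h l x)" .
  qed
  show scale: "vec_linear n f \<Longrightarrow> vec_linear n (\<lambda>w. c * f w)" for c
    by (simp add: vec_linear_def mult.assoc flip: sum_distrib_left)
  show "vec_linear n f \<Longrightarrow> vec_linear n (\<lambda>w. f w / c)"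
    using scale[of "1 / c"] by simp
qed (simp_all add: vec_linear_def distrib_right left_diff_distrib sum.distrib sum_subtractf)

text \<open>Reduces the action of a matrix row to a comparison of single entries with a linear form
  at the unit vectors; no product is expanded afterwards.\<close>

lemma mult_mat_vec_index_linear:
  assumes "M \<in> carrier_mat n n" "x \<in> carrier_vec n" "i < n" "vec_linear n f"
    and "\<And>k. k < n \<Longrightarrow> M $$ (i, k) = f (unit_vec n k)"
  shows "(M *\<^sub>v x) $ i = f x"
  using assms by (simp add: scalar_prod_def vec_linear_def)

lemma vec_linear_flux_deriv:
  assumes "p < n" "q < n"
  shows "vec_linear n (\<lambda>w. flux_deriv U w p q)"
  unfolding flux_deriv_def using assms by (intro vec_linear_intros) auto

lemma p_q_block_index:
  assumes "a < 2" "b < 2"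
  shows "p_block U $$ (a, b) = (if b = 0 then - coord U (a + 1) else 0)"
    and "q_block U $$ (a, b) = (if b = 1 then - coord U (a + 1) else 0)"
proof -
  have "a = 0 \<or> a = 1" "b = 0 \<or> b = 1" using assms by auto
  then show "p_block U $$ (a, b) = (if b = 0 then - coord U (a + 1) else 0)"
    and "q_block U $$ (a, b) = (if b = 1 then - coord U (a + 1) else 0)"
    by (auto simp: p_block_def q_block_def mat_of_rows_list_def coord_eqs numeral_2_eq_2)
qed

lemma pair_of_eqs [simp]: "pair_of (2 * j + 1) = j" "pair_of (Suc (2 * j)) = j"
  "pair_of (2 * j + 2) = j" "pair_of (Suc (Suc (2 * j))) = j"
  by (simp_all add: pair_of_def)

lemma position_cases:
  fixes k :: nat
  obtains "k = 0" | m where "k = 2 * m + 1" | m where "k = 2 * m + 2"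
proof (cases "odd k")
  case True
  then show thesis using that(2) by (elim oddE)
next
  case False
  then obtain m where "k = 2 * m" by auto
  then show thesis using that(1) that(3)[of "m - 1"] by (cases m) auto
qed

text \<open>The entry is written through a component of the unit vector, which exhibits the row as a
  linear form. The number \<open>a\<close> is both the place within pair \<open>j\<close> and the
  position of the velocity component in the block.\<close>

lemma P_1_Q_1_index:
  assumes a: "a \<in> {1, 2}" and j: "1 \<le> j" "j \<le> N" and k: "k < 2 * N + 3"
  shows "P_1 N U $$ (2 * j + a, k) = - coord U a * unit_vec (2 * N + 3) k $ (2 * j + 1)" (is ?P)
    and "Q_1 N U $$ (2 * j + a, k) = - coord U a * unit_vec (2 * N + 3) k $ (2 * j + 2)" (is ?Q)
proof -
  have i: "pair_of (2 * j + a) = j" "(2 * j + a + 1) mod 2 = (a + 1) mod 2" "2 * j + a < 2 * N + 3" "3 \<le> 2 * j + a"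
    using a j by auto
  have D: "diag_block_mat (0\<^sub>m 3 3 # replicate N B) $$ (2 * j + a, k)
      = (if 3 \<le> k \<and> j = pair_of k then B $$ ((a + 1) mod 2, (k + 1) mod 2) else 0)"
    if "B \<in> carrier_mat 2 2" for B :: "real mat"
    unfolding diag_block_zero_replicate_index[OF that i(3) k] i(1,2) using i(4) by simp
  have a': "(a + 1) mod 2 + 1 = a" using a by auto
  have b: "p_block U $$ ((a + 1) mod 2, (k + 1) mod 2) = (if odd k then - coord U a else 0)"
    "q_block U $$ ((a + 1) mod 2, (k + 1) mod 2) = (if even k then - coord U a else 0)"
    using p_q_block_index[of "(a + 1) mod 2" "(k + 1) mod 2" U] unfolding a'
    by (simp_all add: mod_2_eq_odd)
  have u: "unit_vec (2 * N + 3) k $ (2 * j + 1) = (if k = 2 * j + 1 then 1 else 0 :: real)"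
    "unit_vec (2 * N + 3) k $ (2 * j + 2) = (if k = 2 * j + 2 then 1 else 0 :: real)"
    using j k by (auto simp: unit_vec_def)
  have "?P \<and> ?Q"
    unfolding P_1_def Q_1_def D[OF p_q_block_carrier(1)] D[OF p_q_block_carrier(2)] b u
    using j(1) by (cases k rule: position_cases) auto
  then show ?P ?Q by auto
qed

lemma P_1_Q_1_index_low:
  assumes "i < 3" "k < 2 * N + 3"
  shows "P_1 N U $$ (i, k) = 0" "Q_1 N U $$ (i, k) = 0"
  unfolding P_1_def Q_1_def using assms
  by (simp_all add: diag_block_zero_replicate_index p_q_block_carrier del: diag_block_mat.simps)


text \<open>Again the entry as a linear form at a unit vector: only the summand
  \<open>l = pair_of k\<close> survives, and the parity of \<open>k\<close> selects one of its two
  terms.\<close>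

lemma Delta_index:
  assumes "i < 2 * N + 3" "k < 2 * N + 3"
  shows "Delta_A N U $$ (i, k) = (let e = unit_vec (2 * N + 3) k in if i = 2 then
      \<Sum>l = 1..N. (coord U (2 * l + 1) * e $ (2 * l + 2) - coord U (2 * l + 2) * e $ (2 * l + 1)) / (2 * real l + 1)
      else 0)" (is "?A = ?A'")
    and "Delta_B N U $$ (i, k) = (let e = unit_vec (2 * N + 3) k in if i = 1 then
      \<Sum>l = 1..N. (coord U (2 * l + 2) * e $ (2 * l + 1) - coord U (2 * l + 1) * e $ (2 * l + 2)) / (2 * real l + 1)
      else 0)" (is "?B = ?B'")
proof -
  have u: "unit_vec (2 * N + 3) k $ (2 * l + 1) = (if k = 2 * l + 1 then 1 else 0 :: real)"
    "unit_vec (2 * N + 3) k $ (2 * l + 2) = (if k = 2 * l + 2 then 1 else 0 :: real)"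
    if "l \<in> {1..N}" for l
    using that assms(2) by (auto simp: unit_vec_def)
  have s: "(\<Sum>l = 1..N. (f l * unit_vec (2 * N + 3) k $ (2 * l + 2) - g l * unit_vec (2 * N + 3) k $ (2 * l + 1)) / (2 * real l + 1))
    = (if 3 \<le> k then (if odd k then - g (pair_of k) else f (pair_of k)) / (2 * real (pair_of k) + 1) else 0)"
    for f g :: "nat \<Rightarrow> real"
  proof -
    have "(\<Sum>l = 1..N. (f l * unit_vec (2 * N + 3) k $ (2 * l + 2) - g l * unit_vec (2 * N + 3) k $ (2 * l + 1)) / (2 * real l + 1))
      = (\<Sum>l = 1..N. if l = pair_of k then if k = 0 then 0 else (if odd k then - g (pair_of k) else f (pair_of k)) / (2 * real (pair_of k) + 1) else 0)"
    proof (rule sum.cong[OF refl])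
      fix l assume "l \<in> {1..N}"
      then show "(f l * unit_vec (2 * N + 3) k $ (2 * l + 2) - g l * unit_vec (2 * N + 3) k $ (2 * l + 1)) / (2 * real l + 1)
        = (if l = pair_of k then if k = 0 then 0 else (if odd k then - g (pair_of k) else f (pair_of k)) / (2 * real (pair_of k) + 1) else 0)"
        unfolding u[OF \<open>l \<in> {1..N}\<close>] by (cases k rule: position_cases) (auto simp: pair_of_def)
    qed
    also have "\<dots> = (if 3 \<le> k then (if odd k then - g (pair_of k) else f (pair_of k)) / (2 * real (pair_of k) + 1) else 0)"
      unfolding sum.delta[OF finite_atLeastAtMost]
      using assms(2) by (cases k rule: position_cases) auto
    finally show ?thesis .
  qed
  have s': "(\<Sum>l = 1..N. (g l * unit_vec (2 * N + 3) k $ (2 * l + 1) - f l * unit_vec (2 * N + 3) k $ (2 * l + 2)) / (2 * real l + 1))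
    = - (if 3 \<le> k then (if odd k then - g (pair_of k) else f (pair_of k)) / (2 * real (pair_of k) + 1) else 0)"
    for f g :: "nat \<Rightarrow> real"
    unfolding s[symmetric] sum_negf[symmetric] by (simp add: minus_divide_left)
  show "?A = ?A'" unfolding Let_def s using assms by (simp add: Delta_A_def coord_eqs Let_def)
  show "?B = ?B'" unfolding Let_def s' using assms by (simp add: Delta_B_def coord_eqs Let_def)
qed

lemma A_G_B_G_carrier:
  assumes "U \<in> state_space N"
  shows "A_G N G U \<in> carrier_mat (2 * N + 3) (2 * N + 3)" "B_G N G U \<in> carrier_mat (2 * N + 3) (2 * N + 3)"
  unfolding A_G_def B_G_def A_L_def B_L_def
  by (rule add_carrier_mat, simp add: Delta_A_def Delta_B_def)+

lemma vec_linear_if: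
  assumes "c \<Longrightarrow> vec_linear n f" "\<not> c \<Longrightarrow> vec_linear n g"
  shows "vec_linear n (\<lambda>w. if c then f w else g w)"
  using assms by (cases c) auto

lemma vec_linear_F_deriv: "i < 2 * N + 3 \<Longrightarrow> vec_linear (2 * N + 3) (\<lambda>w. F_deriv N G U w i)"
  using pair_of_less[of i N] unfolding F_deriv_def Let_def
  by (auto intro!: vec_linear_if vec_linear_intros vec_linear_flux_deriv)

lemma vec_linear_G_deriv: "i < 2 * N + 3 \<Longrightarrow> vec_linear (2 * N + 3) (\<lambda>w. G_deriv N G U w i)"
  using pair_of_less[of i N] unfolding G_deriv_def Let_def
  by (auto intro!: vec_linear_if vec_linear_intros vec_linear_flux_deriv)

lemma A_G_B_G_index:
  assumes U: "U \<in> state_space N" and ik: "i < 2 * N + 3" "k < 2 * N + 3"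
  shows "A_G N G U $$ (i, k) = F_deriv N G U (unit_vec (2 * N + 3) k) i + P_1 N U $$ (i, k) + Delta_A N U $$ (i, k)"
    and "B_G N G U $$ (i, k) = G_deriv N G U (unit_vec (2 * N + 3) k) i + Q_1 N U $$ (i, k) + Delta_B N U $$ (i, k)"
  using ik P_1_Q_1_carrier[of N U] U
  by (simp_all add: A_G_def B_G_def A_L_def B_L_def Delta_A_def Delta_B_def jacobian_index state_space_def
    del: index_add_mat add: index_add_mat(1))


text \<open>Each row is compared with a linear form on unit vectors. The second sum in row 2 stems
  from \<open>Delta_A\<close>, the terms with a negated \<open>coord\<close> from
  \<open>P_1\<close>, the rest from the Jacobian.\<close>

lemma A_G_mult_vec_index:
  assumes U: "U \<in> state_space N" and x: "x \<in> carrier_vec (2 * N + 3)"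
  shows "(A_G N G U *\<^sub>v x) $ 0 = x $ 1"
    and "(A_G N G U *\<^sub>v x) $ 1 = flux_deriv U x 1 1
       + (\<Sum>l = 1..N. flux_deriv U x (2 * l + 1) (2 * l + 1) / (2 * real l + 1)) + G * height U * x $ 0"
    and "(A_G N G U *\<^sub>v x) $ 2 = flux_deriv U x 1 2
       + (\<Sum>l = 1..N. flux_deriv U x (2 * l + 1) (2 * l + 2) / (2 * real l + 1))
       + (\<Sum>l = 1..N. (coord U (2 * l + 1) * x $ (2 * l + 2) - coord U (2 * l + 2) * x $ (2 * l + 1)) / (2 * real l + 1))"
    and "\<lbrakk>1 \<le> j; j \<le> N\<rbrakk> \<Longrightarrow> (A_G N G U *\<^sub>v x) $ (2 * j + 1)
       = 2 * flux_deriv U x 1 (2 * j + 1) + - coord U 1 * x $ (2 * j + 1)"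
    and "\<lbrakk>1 \<le> j; j \<le> N\<rbrakk> \<Longrightarrow> (A_G N G U *\<^sub>v x) $ (2 * j + 2)
       = flux_deriv U x 1 (2 * j + 2) + flux_deriv U x 2 (2 * j + 1) + - coord U 2 * x $ (2 * j + 1)"
proof -
  note row = mult_mat_vec_index_linear[OF A_G_B_G_carrier(1)[OF U] x]
  note lin = vec_linear_intros vec_linear_flux_deriv
  show "(A_G N G U *\<^sub>v x) $ 0 = x $ 1"
    by (rule row) (auto intro!: lin simp: A_G_B_G_index[OF U] P_1_Q_1_index_low Delta_index F_deriv_def)
  show "(A_G N G U *\<^sub>v x) $ 1 = flux_deriv U x 1 1
       + (\<Sum>l = 1..N. flux_deriv U x (2 * l + 1) (2 * l + 1) / (2 * real l + 1)) + G * height U * x $ 0"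
    by (rule row) (auto intro!: lin simp: A_G_B_G_index[OF U] P_1_Q_1_index_low Delta_index F_deriv_def simp del: One_nat_def)
  show "(A_G N G U *\<^sub>v x) $ 2 = flux_deriv U x 1 2
       + (\<Sum>l = 1..N. flux_deriv U x (2 * l + 1) (2 * l + 2) / (2 * real l + 1))
       + (\<Sum>l = 1..N. (coord U (2 * l + 1) * x $ (2 * l + 2) - coord U (2 * l + 2) * x $ (2 * l + 1)) / (2 * real l + 1))"
    by (rule row) (auto intro!: lin simp: A_G_B_G_index[OF U] P_1_Q_1_index_low Delta_index F_deriv_def simp del: One_nat_def)
  assume j: "1 \<le> j" "j \<le> N"
  then have *: "2 * j + 1 \<noteq> 1" "2 * j + 1 \<noteq> 2" "2 * j + 2 \<noteq> 1" "2 * j + 2 \<noteq> 2" by simp_all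
  show "(A_G N G U *\<^sub>v x) $ (2 * j + 1) = 2 * flux_deriv U x 1 (2 * j + 1) + - coord U 1 * x $ (2 * j + 1)"
    by (rule row) (use j * in \<open>auto intro!: lin simp: A_G_B_G_index[OF U] P_1_Q_1_index[OF _ j] Delta_index F_deriv_def
      simp del: One_nat_def add_2_eq_Suc'\<close>)
  show "(A_G N G U *\<^sub>v x) $ (2 * j + 2)
       = flux_deriv U x 1 (2 * j + 2) + flux_deriv U x 2 (2 * j + 1) + - coord U 2 * x $ (2 * j + 1)"
    by (rule row) (use j * in \<open>auto intro!: lin simp: A_G_B_G_index[OF U] P_1_Q_1_index[OF _ j] Delta_index F_deriv_def
      simp del: One_nat_def add_2_eq_Suc'\<close>)
qed

lemma B_G_mult_vec_index:
  assumes U: "U \<in> state_space N" and x: "x \<in> carrier_vec (2 * N + 3)"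
  shows "(B_G N G U *\<^sub>v x) $ 0 = x $ 2"
    and "(B_G N G U *\<^sub>v x) $ 1 = flux_deriv U x 1 2
       + (\<Sum>l = 1..N. flux_deriv U x (2 * l + 1) (2 * l + 2) / (2 * real l + 1))
       + (\<Sum>l = 1..N. (coord U (2 * l + 2) * x $ (2 * l + 1) - coord U (2 * l + 1) * x $ (2 * l + 2)) / (2 * real l + 1))"
    and "(B_G N G U *\<^sub>v x) $ 2 = flux_deriv U x 2 2
       + (\<Sum>l = 1..N. flux_deriv U x (2 * l + 2) (2 * l + 2) / (2 * real l + 1)) + G * height U * x $ 0"
    and "\<lbrakk>1 \<le> j; j \<le> N\<rbrakk> \<Longrightarrow> (B_G N G U *\<^sub>v x) $ (2 * j + 1)
       = flux_deriv U x 1 (2 * j + 2) + flux_deriv U x 2 (2 * j + 1) + - coord U 1 * x $ (2 * j + 2)"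
    and "\<lbrakk>1 \<le> j; j \<le> N\<rbrakk> \<Longrightarrow> (B_G N G U *\<^sub>v x) $ (2 * j + 2)
       = 2 * flux_deriv U x 2 (2 * j + 2) + - coord U 2 * x $ (2 * j + 2)"
proof -
  note row = mult_mat_vec_index_linear[OF A_G_B_G_carrier(2)[OF U] x]
  note lin = vec_linear_intros vec_linear_flux_deriv
  show "(B_G N G U *\<^sub>v x) $ 0 = x $ 2"
    by (rule row) (auto intro!: lin simp: A_G_B_G_index[OF U] P_1_Q_1_index_low Delta_index G_deriv_def)
  show "(B_G N G U *\<^sub>v x) $ 1 = flux_deriv U x 1 2
       + (\<Sum>l = 1..N. flux_deriv U x (2 * l + 1) (2 * l + 2) / (2 * real l + 1))
       + (\<Sum>l = 1..N. (coord U (2 * l + 2) * x $ (2 * l + 1) - coord U (2 * l + 1) * x $ (2 * l + 2)) / (2 * real l + 1))"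
    by (rule row) (auto intro!: lin simp: A_G_B_G_index[OF U] P_1_Q_1_index_low Delta_index G_deriv_def simp del: One_nat_def)
  show "(B_G N G U *\<^sub>v x) $ 2 = flux_deriv U x 2 2
       + (\<Sum>l = 1..N. flux_deriv U x (2 * l + 2) (2 * l + 2) / (2 * real l + 1)) + G * height U * x $ 0"
    by (rule row) (auto intro!: lin simp: A_G_B_G_index[OF U] P_1_Q_1_index_low Delta_index G_deriv_def simp del: One_nat_def)
  assume j: "1 \<le> j" "j \<le> N"
  then have *: "2 * j + 1 \<noteq> 1" "2 * j + 1 \<noteq> 2" "2 * j + 2 \<noteq> 1" "2 * j + 2 \<noteq> 2" by simp_all
  show "(B_G N G U *\<^sub>v x) $ (2 * j + 1)
       = flux_deriv U x 1 (2 * j + 2) + flux_deriv U x 2 (2 * j + 1) + - coord U 1 * x $ (2 * j + 2)"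
    by (rule row) (use j * in \<open>auto intro!: lin simp: A_G_B_G_index[OF U] P_1_Q_1_index[OF _ j] Delta_index G_deriv_def
      simp del: One_nat_def add_2_eq_Suc'\<close>)
  show "(B_G N G U *\<^sub>v x) $ (2 * j + 2) = 2 * flux_deriv U x 2 (2 * j + 2) + - coord U 2 * x $ (2 * j + 2)"
    by (rule row) (use j * in \<open>auto intro!: lin simp: A_G_B_G_index[OF U] P_1_Q_1_index[OF _ j] Delta_index G_deriv_def
      simp del: One_nat_def add_2_eq_Suc'\<close>)
qed

section \<open>Action of the directional matrix\<close>

text \<open>
  \<open>rel U x p\<close> is \<open>h\<close> times the variation of the primitive variable \<open>coord U p\<close> in direction \<open>x\<close>.
\<close>

definition rel :: "real vec \<Rightarrow> real vec \<Rightarrow> nat \<Rightarrow> real" where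
  "rel U x p = x $ p - coord U p * x $ 0"

text \<open>The normal components \<open>a\<^sub>j\<close> of the overview, with
  \<open>n = (c, s)\<close>; index 0 gives that of the mean velocity.\<close>

definition nvel :: "real \<Rightarrow> real \<Rightarrow> real vec \<Rightarrow> nat \<Rightarrow> real" where
  "nvel c s U j = c * coord U (2 * j + 1) + s * coord U (2 * j + 2)"

lemma add_smult_mult_vec_index:
  fixes A B :: "real mat"
  assumes "A \<in> carrier_mat n n" "B \<in> carrier_mat n n" "x \<in> carrier_vec n" "i < n"
  shows "((c \<cdot>\<^sub>m A + s \<cdot>\<^sub>m B) *\<^sub>v x) $ i = c * (A *\<^sub>v x) $ i + s * (B *\<^sub>v x) $ i"
  using assms by (simp add: scalar_prod_def sum_distrib_left sum.distrib algebra_simps)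

text \<open>In the variables \<open>x $ 0\<close> and \<open>rel U x\<close> the directional matrix
  is \<open>nvel c s U 0\<close> times the identity plus the operator \<open>L\<close> of the
  overview.\<close>

lemma directional_mult_vec:
  fixes c s G :: real
  assumes U: "U \<in> state_space N" and x: "x \<in> carrier_vec (2 * N + 3)"
  defines "x' \<equiv> (c \<cdot>\<^sub>m A_G N G U + s \<cdot>\<^sub>m B_G N G U) *\<^sub>v x"
  shows "x' $ 0 = nvel c s U 0 * x $ 0 + (c * rel U x 1 + s * rel U x 2)"
    and "rel U x' 1 = nvel c s U 0 * rel U x 1
      + (\<Sum>l = 1..N. nvel c s U l * (2 * rel U x (2 * l + 1) + coord U (2 * l + 1) * x $ 0) / (2 * real l + 1))
      + c * (G * height U) * x $ 0"
    and "rel U x' 2 = nvel c s U 0 * rel U x 2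
      + (\<Sum>l = 1..N. nvel c s U l * (2 * rel U x (2 * l + 2) + coord U (2 * l + 2) * x $ 0) / (2 * real l + 1))
      + s * (G * height U) * x $ 0"
    and "\<lbrakk>1 \<le> j; j \<le> N\<rbrakk> \<Longrightarrow>
      rel U x' (2 * j + 1) = nvel c s U 0 * rel U x (2 * j + 1) + nvel c s U j * rel U x 1"
    and "\<lbrakk>1 \<le> j; j \<le> N\<rbrakk> \<Longrightarrow>
      rel U x' (2 * j + 2) = nvel c s U 0 * rel U x (2 * j + 2) + nvel c s U j * rel U x 2"
proof -
  have ix: "x' $ i = c * (A_G N G U *\<^sub>v x) $ i + s * (B_G N G U *\<^sub>v x) $ i" if "i < 2 * N + 3" for i
    unfolding x'_def by (rule add_smult_mult_vec_index[OF A_G_B_G_carrier[OF U] x that])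
  note AB = A_G_mult_vec_index[OF U x] B_G_mult_vec_index[OF U x]
  have n0: "nvel c s U 0 = c * coord U 1 + s * coord U 2" by (simp add: nvel_def numeral_2_eq_2)
  have x0: "x' $ 0 = c * x $ 1 + s * x $ 2" by (simp add: ix AB)
  have x1: "x' $ 1 = c * (A_G N G U *\<^sub>v x) $ 1 + s * (B_G N G U *\<^sub>v x) $ 1"
    and x2: "x' $ 2 = c * (A_G N G U *\<^sub>v x) $ 2 + s * (B_G N G U *\<^sub>v x) $ 2"
    by (rule ix; simp)+
  from x0 show "x' $ 0 = nvel c s U 0 * x $ 0 + (c * rel U x 1 + s * rel U x 2)"
    by (simp add: n0 rel_def algebra_simps)
  \<comment> \<open>The correction cancels the term of \<open>flux_deriv\<close> with
    \<open>coord U (2 * l + 1) * x $ (2 * l + 2)\<close> and doubles the other first-order one. What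
    remains has the common factor \<open>nvel c s U l\<close>.\<close>
  have "c * (\<Sum>l = 1..N. flux_deriv U x (2 * l + 1) (2 * l + 1) / (2 * real l + 1))
      + s * ((\<Sum>l = 1..N. flux_deriv U x (2 * l + 1) (2 * l + 2) / (2 * real l + 1))
       + (\<Sum>l = 1..N. (coord U (2 * l + 2) * x $ (2 * l + 1) - coord U (2 * l + 1) * x $ (2 * l + 2)) / (2 * real l + 1)))
    = (\<Sum>l = 1..N. nvel c s U l * (2 * rel U x (2 * l + 1) + coord U (2 * l + 1) * x $ 0) / (2 * real l + 1))"
    unfolding sum_distrib_left sum.distrib[symmetric]
    by (rule sum.cong[OF refl]) (simp add: flux_deriv_def rel_def nvel_def divide_inverse algebra_simps)
  then show "rel U x' 1 = nvel c s U 0 * rel U x 1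
      + (\<Sum>l = 1..N. nvel c s U l * (2 * rel U x (2 * l + 1) + coord U (2 * l + 1) * x $ 0) / (2 * real l + 1))
      + c * (G * height U) * x $ 0"
    unfolding rel_def[of U x' 1] x1 x0 AB
    by (simp add: n0 rel_def flux_deriv_def algebra_simps)
  have "c * ((\<Sum>l = 1..N. flux_deriv U x (2 * l + 1) (2 * l + 2) / (2 * real l + 1))
       + (\<Sum>l = 1..N. (coord U (2 * l + 1) * x $ (2 * l + 2) - coord U (2 * l + 2) * x $ (2 * l + 1)) / (2 * real l + 1)))
      + s * (\<Sum>l = 1..N. flux_deriv U x (2 * l + 2) (2 * l + 2) / (2 * real l + 1))
    = (\<Sum>l = 1..N. nvel c s U l * (2 * rel U x (2 * l + 2) + coord U (2 * l + 2) * x $ 0) / (2 * real l + 1))"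
    unfolding sum_distrib_left sum.distrib[symmetric]
    by (rule sum.cong[OF refl]) (simp add: flux_deriv_def rel_def nvel_def divide_inverse algebra_simps)
  then show "rel U x' 2 = nvel c s U 0 * rel U x 2
      + (\<Sum>l = 1..N. nvel c s U l * (2 * rel U x (2 * l + 2) + coord U (2 * l + 2) * x $ 0) / (2 * real l + 1))
      + s * (G * height U) * x $ 0"
    unfolding rel_def[of U x' 2] x2 x0 AB
    by (simp add: n0 rel_def flux_deriv_def algebra_simps)
  assume j: "1 \<le> j" "j \<le> N"
  show "rel U x' (2 * j + 1) = nvel c s U 0 * rel U x (2 * j + 1) + nvel c s U j * rel U x 1"
    using j by (simp only: rel_def[of U x'] ix x0 AB(4,9)[OF j] n0)
      (simp add: ix AB(4,9)[OF j] nvel_def rel_def flux_deriv_def algebra_simps)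
  show "rel U x' (2 * j + 2) = nvel c s U 0 * rel U x (2 * j + 2) + nvel c s U j * rel U x 2"
    using j by (simp only: rel_def[of U x'] ix x0 AB(5,10)[OF j] n0)
      (simp add: ix AB(5,10)[OF j] nvel_def rel_def flux_deriv_def algebra_simps)
qed

section \<open>Components along the direction (c, s) and across it, along (-s, c)\<close>

definition nrel :: "real \<Rightarrow> real \<Rightarrow> real vec \<Rightarrow> real vec \<Rightarrow> nat \<Rightarrow> real" where
  "nrel c s U x j = c * rel U x (2 * j + 1) + s * rel U x (2 * j + 2)"

definition trel :: "real \<Rightarrow> real \<Rightarrow> real vec \<Rightarrow> real vec \<Rightarrow> nat \<Rightarrow> real" where
  "trel c s U x j = c * rel U x (2 * j + 2) - s * rel U x (2 * j + 1)"

definition tvel :: "real \<Rightarrow> real \<Rightarrow> real vec \<Rightarrow> nat \<Rightarrow> real" where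
  "tvel c s U j = c * coord U (2 * j + 2) - s * coord U (2 * j + 1)"

definition shifted :: "nat \<Rightarrow> real \<Rightarrow> real \<Rightarrow> real \<Rightarrow> real vec \<Rightarrow> real \<Rightarrow> real vec \<Rightarrow> real vec" where
  "shifted N G c s U \<mu> x = (c \<cdot>\<^sub>m A_G N G U + s \<cdot>\<^sub>m B_G N G U) *\<^sub>v x - \<mu> \<cdot>\<^sub>v x"

lemma shifted_carrier:
  assumes "U \<in> state_space N" "x \<in> carrier_vec (2 * N + 3)"
  shows "shifted N G c s U \<mu> x \<in> carrier_vec (2 * N + 3)"
  unfolding shifted_def using assms(2) A_G_B_G_carrier[OF assms(1), of G]
  by (intro minus_carrier_vec mult_mat_vec_carrier add_carrier_mat smult_carrier_mat smult_carrier_vec) auto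

text \<open>Projects \<open>directional_mult_vec\<close> onto \<open>(c, s)\<close> and
  \<open>(-s, c)\<close>, for the map \<open>L - \<nu>\<close>. The gravity term is parallel to
  \<open>(c, s)\<close>, so it enters only the normal equation, with factor
  \<open>c\<^sup>2 + s\<^sup>2 = 1\<close>.\<close>

lemma nrel_trel_shifted:
  fixes c s G \<nu> :: real
  assumes U: "U \<in> state_space N" and x: "x \<in> carrier_vec (2 * N + 3)" and cs: "c\<^sup>2 + s\<^sup>2 = 1"
  defines "y \<equiv> shifted N G c s U (nvel c s U 0 + \<nu>) x"
  shows "y $ 0 = nrel c s U x 0 - \<nu> * x $ 0"
    and "nrel c s U y 0 = (\<Sum>l = 1..N. nvel c s U l * (2 * nrel c s U x l + nvel c s U l * x $ 0) / (2 * real l + 1))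
      + G * height U * x $ 0 - \<nu> * nrel c s U x 0"
    and "trel c s U y 0 = (\<Sum>l = 1..N. nvel c s U l * (2 * trel c s U x l + tvel c s U l * x $ 0) / (2 * real l + 1))
      - \<nu> * trel c s U x 0"
    and "\<lbrakk>1 \<le> j; j \<le> N\<rbrakk> \<Longrightarrow> nrel c s U y j = nvel c s U j * nrel c s U x 0 - \<nu> * nrel c s U x j"
    and "\<lbrakk>1 \<le> j; j \<le> N\<rbrakk> \<Longrightarrow> trel c s U y j = nvel c s U j * trel c s U x 0 - \<nu> * trel c s U x j"
proof -
  let ?Mx = "(c \<cdot>\<^sub>m A_G N G U + s \<cdot>\<^sub>m B_G N G U) *\<^sub>v x"
  let ?\<mu> = "nvel c s U 0 + \<nu>"
  note M = directional_mult_vec[OF U x, where c = c and s = s and G = G]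
  have M_carrier: "?Mx \<in> carrier_vec (2 * N + 3)"
    using A_G_B_G_carrier[OF U, of G] x by (intro mult_mat_vec_carrier add_carrier_mat smult_carrier_mat) auto
  have ix: "y $ p = ?Mx $ p - ?\<mu> * x $ p" if "p < 2 * N + 3" for p
    using that x M_carrier unfolding y_def shifted_def by (simp del: index_mult_mat_vec)
  have ry: "rel U y p = rel U ?Mx p - ?\<mu> * rel U x p" if "p < 2 * N + 3" for p
    using that by (simp add: rel_def ix algebra_simps del: index_mult_mat_vec)
  have zero: "nrel c s U z 0 = c * rel U z 1 + s * rel U z 2" "trel c s U z 0 = c * rel U z 2 - s * rel U z 1" for z
    by (simp_all add: nrel_def trel_def numeral_2_eq_2)
  have r12: "rel U y 1 = rel U ?Mx 1 - ?\<mu> * rel U x 1" "rel U y 2 = rel U ?Mx 2 - ?\<mu> * rel U x 2"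
    by (rule ry; simp)+
  have y0: "y $ 0 = ?Mx $ 0 - ?\<mu> * x $ 0" by (rule ix) simp
  show "y $ 0 = nrel c s U x 0 - \<nu> * x $ 0"
    unfolding y0 M(1) zero by (simp add: algebra_simps)
  let ?s1 = "\<Sum>l = 1..N. nvel c s U l * (2 * rel U x (2 * l + 1) + coord U (2 * l + 1) * x $ 0) / (2 * real l + 1)"
  let ?s2 = "\<Sum>l = 1..N. nvel c s U l * (2 * rel U x (2 * l + 2) + coord U (2 * l + 2) * x $ 0) / (2 * real l + 1)"
  have sn: "(\<Sum>l = 1..N. nvel c s U l * (2 * nrel c s U x l + nvel c s U l * x $ 0) / (2 * real l + 1)) = c * ?s1 + s * ?s2"
    unfolding sum_distrib_left sum.distrib[symmetric]
    by (rule sum.cong[OF refl]) (simp add: nrel_def nvel_def divide_inverse algebra_simps)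
  have st: "(\<Sum>l = 1..N. nvel c s U l * (2 * trel c s U x l + tvel c s U l * x $ 0) / (2 * real l + 1)) = c * ?s2 - s * ?s1"
    unfolding sum_distrib_left sum_subtractf[symmetric]
    by (rule sum.cong[OF refl]) (simp add: trel_def tvel_def nvel_def divide_inverse algebra_simps)
  have "nrel c s U y 0 = c * ?s1 + s * ?s2 + (c\<^sup>2 + s\<^sup>2) * (G * height U * x $ 0) - \<nu> * nrel c s U x 0"
    unfolding zero r12 M(2,3) by (simp only: algebra_simps power2_eq_square)
  then show "nrel c s U y 0 = (\<Sum>l = 1..N. nvel c s U l * (2 * nrel c s U x l + nvel c s U l * x $ 0) / (2 * real l + 1))
      + G * height U * x $ 0 - \<nu> * nrel c s U x 0"
    unfolding sn cs by simp
  show "trel c s U y 0 = (\<Sum>l = 1..N. nvel c s U l * (2 * trel c s U x l + tvel c s U l * x $ 0) / (2 * real l + 1))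
      - \<nu> * trel c s U x 0"
    unfolding st zero r12 M(2,3) by (simp only: algebra_simps)
  assume j: "1 \<le> j" "j \<le> N"
  have rj: "rel U y (2 * j + 1) = rel U ?Mx (2 * j + 1) - ?\<mu> * rel U x (2 * j + 1)"
    "rel U y (2 * j + 2) = rel U ?Mx (2 * j + 2) - ?\<mu> * rel U x (2 * j + 2)"
    by (rule ry; use j in simp)+
  show "nrel c s U y j = nvel c s U j * nrel c s U x 0 - \<nu> * nrel c s U x j"
    unfolding zero nrel_def[of c s U _ j] rj M(4,5)[OF j] by (simp only: algebra_simps)
  show "trel c s U y j = nvel c s U j * trel c s U x 0 - \<nu> * trel c s U x j"
    unfolding zero trel_def[of c s U _ j] rj M(4,5)[OF j] by (simp only: algebra_simps)
qed

text \<open>The form of the vectors in the range of \<open>L\<close>, with the four remaining scalars \<open>p, q, r, t\<close>.\<close>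

definition reduced where
  "reduced N c s U x p q r t \<longleftrightarrow> x \<in> carrier_vec (2 * N + 3) \<and> x $ 0 = p
    \<and> nrel c s U x 0 = q \<and> trel c s U x 0 = t
    \<and> (\<forall>j \<in> {1..N}. nrel c s U x j = nvel c s U j * p \<and> trel c s U x j = nvel c s U j * r)"

text \<open>With \<open>\<nu> = 0\<close> the pairs \<open>j \<ge> 1\<close> are multiples of the
  velocity pair, which gives \<open>p\<close> and \<open>r\<close>. The scalar \<open>t\<close> is
  stated explicitly because it has to vanish when all \<open>nvel\<close> do.\<close>

lemma reduced_shifted_first:
  assumes "U \<in> state_space N" "x \<in> carrier_vec (2 * N + 3)" "c\<^sup>2 + s\<^sup>2 = 1"
  shows "\<exists>q. reduced N c s U (shifted N G c s U (nvel c s U 0) x) (nrel c s U x 0) q (trel c s U x 0)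
    (\<Sum>l = 1..N. nvel c s U l * (2 * trel c s U x l + tvel c s U l * x $ 0) / (2 * real l + 1))"
  using nrel_trel_shifted[OF assms, where G = G and \<nu> = 0] shifted_carrier[OF assms(1,2)]
  by (auto simp: reduced_def)

definition speed2 :: "nat \<Rightarrow> real \<Rightarrow> real \<Rightarrow> real vec \<Rightarrow> real" where
  "speed2 N c s U = (\<Sum>l = 1..N. (nvel c s U l)\<^sup>2 / (2 * real l + 1))"

text \<open>The one coefficient through which \<open>(p, q)\<close> acts on \<open>(r, t)\<close> in
  \<open>reduced_shifted\<close>.\<close>

definition coupling :: "nat \<Rightarrow> real \<Rightarrow> real \<Rightarrow> real vec \<Rightarrow> real" where
  "coupling N c s U = (\<Sum>l = 1..N. nvel c s U l * tvel c s U l / (2 * real l + 1))"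

text \<open>\<open>L\<close> acts on the four scalars block triangularly: \<open>(p, q)\<close>
  evolves by itself with square \<open>G h + 3 S\<close>, and \<open>(r, t)\<close> with square
  \<open>2 S\<close> plus a source proportional to \<open>p\<close>.\<close>

lemma reduced_shifted:
  assumes U: "U \<in> state_space N" and cs: "c\<^sup>2 + s\<^sup>2 = 1" and x: "reduced N c s U x p q r t"
  shows "reduced N c s U (shifted N G c s U (nvel c s U 0 + \<nu>) x)
    (q - \<nu> * p) ((G * height U + 3 * speed2 N c s U) * p - \<nu> * q)
    (t - \<nu> * r) (2 * speed2 N c s U * r + coupling N c s U * p - \<nu> * t)"
proof -
  have xc: "x \<in> carrier_vec (2 * N + 3)" and x0: "x $ 0 = p" "nrel c s U x 0 = q" "trel c s U x 0 = t"
    and xj: "\<And>j. j \<in> {1..N} \<Longrightarrow> nrel c s U x j = nvel c s U j * p"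
      "\<And>j. j \<in> {1..N} \<Longrightarrow> trel c s U x j = nvel c s U j * r"
    using x by (auto simp: reduced_def)
  note y = nrel_trel_shifted[OF U xc cs, where G = G and \<nu> = \<nu>]
  \<comment> \<open>The factor 3 is 2 from \<open>nrel c s U x l = nvel c s U l * p\<close> and 1
    from \<open>x $ 0 = p\<close>.\<close>
  have sn: "(\<Sum>l = 1..N. nvel c s U l * (2 * nrel c s U x l + nvel c s U l * p) / (2 * real l + 1)) = 3 * speed2 N c s U * p"
    unfolding speed2_def sum_distrib_left sum_distrib_right
    by (rule sum.cong[OF refl]) (simp add: xj power2_eq_square)
  have st: "(\<Sum>l = 1..N. nvel c s U l * (2 * trel c s U x l + tvel c s U l * p) / (2 * real l + 1))
      = 2 * speed2 N c s U * r + coupling N c s U * p"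
    unfolding speed2_def coupling_def sum_distrib_left sum_distrib_right sum.distrib[symmetric]
    by (rule sum.cong[OF refl]) (simp add: xj power2_eq_square divide_inverse algebra_simps)
  show ?thesis
    unfolding reduced_def y(1-3) sn st x0
    using shifted_carrier[OF U xc] y(4,5) xj x0 by (auto simp: algebra_simps)
qed

text \<open>The scalar \<open>r\<close> enters the vector only through the products
  \<open>nvel c s U j * r\<close>. They vanish if \<open>r = 0\<close>, and also in the degenerate
  case where every \<open>nvel\<close> is zero.\<close>

lemma reduced_zero:
  assumes x: "reduced N c s U x 0 0 r 0" and cs: "c\<^sup>2 + s\<^sup>2 = 1"
    and r: "\<And>j. j \<in> {1..N} \<Longrightarrow> nvel c s U j * r = 0"
  shows "x = 0\<^sub>v (2 * N + 3)"
proof (rule eq_vecI)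
  have xc: "x \<in> carrier_vec (2 * N + 3)" using x by (simp add: reduced_def)
  then show "dim_vec x = dim_vec (0\<^sub>v (2 * N + 3))" by simp
  have nt: "nrel c s U x j = 0" "trel c s U x j = 0" if "j \<le> N" for j
    using x r[of j] that by (cases "j = 0"; auto simp: reduced_def)+
  fix i assume i: "i < dim_vec (0\<^sub>v (2 * N + 3) :: real vec)"
  show "x $ i = 0\<^sub>v (2 * N + 3) $ i"
  proof -
    have x0: "x $ 0 = 0" using x by (simp add: reduced_def)
    \<comment> \<open>A rotation is invertible, so vanishing normal and tangential components give a
      vanishing pair.\<close>
    have inv: "a = 0 \<and> b = 0" if ab: "c * a + s * b = 0" "c * b - s * a = 0" for a b
    proof -
      have "(c\<^sup>2 + s\<^sup>2) * a = c * (c * a + s * b) - s * (c * b - s * a)"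
        "(c\<^sup>2 + s\<^sup>2) * b = s * (c * a + s * b) + c * (c * b - s * a)"
        by (simp_all add: algebra_simps power2_eq_square)
      then show ?thesis unfolding ab cs by simp
    qed
    have "x $ (2 * j + 1) = 0 \<and> x $ (2 * j + 2) = 0" if "j \<le> N" for j
      using inv[OF nt(1)[OF that, unfolded nrel_def] nt(2)[OF that, unfolded trel_def]] x0 by (simp add: rel_def)
    then show ?thesis using i x0 by (cases i rule: position_cases) auto
  qed
qed

theorem theorem3p5:
  fixes N :: nat and G :: real
  assumes "N \<ge> 1" and "G > 0"
  shows "(\<forall>\<theta>. \<forall>U \<in> state_space N.
            real_diagonalizable (cos \<theta> \<cdot>\<^sub>m A_G N G U + sin \<theta> \<cdot>\<^sub>m B_G N G U))
         \<and> globally_hyperbolic_on (state_space N) (A_G N G) (B_G N G)"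
proof -
  have "real_diagonalizable (cos \<theta> \<cdot>\<^sub>m A_G N G U + sin \<theta> \<cdot>\<^sub>m B_G N G U)"
    if U: "U \<in> state_space N" for \<theta> U
  proof -
    define c where "c = cos \<theta>"
    define s where "s = sin \<theta>"
    have cs: "c\<^sup>2 + s\<^sup>2 = 1" by (simp add: c_def s_def)
    let ?M = "c \<cdot>\<^sub>m A_G N G U + s \<cdot>\<^sub>m B_G N G U"
    have M: "?M \<in> carrier_mat (2 * N + 3) (2 * N + 3)"
      using A_G_B_G_carrier[OF U, of G] by (intro add_carrier_mat smult_carrier_mat)
    define S where "S = speed2 N c s U"
    define T where "T = coupling N c s U"
    define u where "u = nvel c s U 0"
    \<comment> \<open>Relative to \<open>u\<close>, the eigenvalues of the two diagonal blocks are
      plus and minus \<open>a\<close> for \<open>(p, q)\<close>, plus and minus \<open>b\<close> for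
      \<open>(r, t)\<close>.\<close>
    define a where "a = sqrt (G * height U + 3 * S)"
    define b where "b = sqrt (2 * S)"
    have S: "S \<ge> 0" unfolding S_def speed2_def by (intro sum_nonneg) simp
    have h: "G * height U > 0" using U assms(2) by (simp add: height_def state_space_def)
    have a2: "a * a = G * height U + 3 * S" and b2: "b * b = 2 * S"
      using S h by (simp_all add: a_def b_def)
    have ab: "b < a" "0 \<le> b" using S h by (simp_all add: a_def b_def)
    \<comment> \<open>With \<open>a * a\<close> and \<open>b * b\<close> as coefficients, the
      cancellations below are polynomial identities.\<close>
    note step = reduced_shifted[where G = G, OF U cs, folded S_def T_def u_def, folded a2 b2]
    have "(\<lambda>\<mu> w. ?M *\<^sub>v w - \<mu> \<cdot>\<^sub>v w) = shifted N G c s U"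
      by (intro ext) (simp add: shifted_def)
    note diag = real_diagonalizableI[OF M, unfolded this]
    show ?thesis
    proof (cases "S = 0")
      case False
      then have b0: "b > 0" using S by (simp add: b_def)
      \<comment> \<open>\<open>fold\<close> applies the head first: \<open>u\<close> brings the
        vector into reduced form, the next two factors kill \<open>p\<close> and \<open>q\<close>
        and with them the coupling, the last two kill \<open>r\<close> and \<open>t\<close>.\<close>
      let ?ls = "[u, u + a, u + - a, u + b, u + - b]"
      have "fold (shifted N G c s U) ?ls v = 0\<^sub>v (2 * N + 3)" if v: "v \<in> carrier_vec (2 * N + 3)" for v
      proof -
        obtain p q r t where "reduced N c s U (shifted N G c s U u v) p q r t"
          using reduced_shifted_first[OF U v cs, of G] unfolding u_def by blast
        from step[OF step[OF this, of a], of "- a"]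
        obtain r' t' where "reduced N c s U (shifted N G c s U (u + - a) (shifted N G c s U (u + a)
            (shifted N G c s U u v))) 0 0 r' t'"
          by (auto simp: algebra_simps)
        from step[OF step[OF this, of b], of "- b"]
        have "reduced N c s U (fold (shifted N G c s U) ?ls v) 0 0 0 0"
          by (simp add: algebra_simps)
        then show ?thesis by (rule reduced_zero[OF _ cs]) simp
      qed
      then show ?thesis
        unfolding c_def[symmetric] s_def[symmetric] by (intro diag[of ?ls]) (use ab b0 in auto)
    next
      \<comment> \<open>Here \<open>b = 0\<close>, so the list above would repeat \<open>u\<close>.
        But \<open>S = 0\<close> is a vanishing sum of nonnegative terms: every \<open>nvel\<close>
        is zero, \<open>t\<close> vanishes from the first factor on, and \<open>r\<close> no longer
        affects the vector.\<close>
      case True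
      have "(nvel c s U l)\<^sup>2 / (2 * real l + 1) = 0" if "l \<in> {1..N}" for l
        using True that unfolding S_def speed2_def by (subst (asm) sum_nonneg_eq_0_iff) auto
      then have n0: "nvel c s U l = 0" if "l \<in> {1..N}" for l
        using that by fastforce
      have T0: "T = 0" unfolding T_def coupling_def by (rule sum.neutral) (simp add: n0)
      let ?ls = "[u, u + a, u + - a]"
      have "fold (shifted N G c s U) ?ls v = 0\<^sub>v (2 * N + 3)" if v: "v \<in> carrier_vec (2 * N + 3)" for v
      proof -
        have "(\<Sum>l = 1..N. nvel c s U l * (2 * trel c s U v l + tvel c s U l * v $ 0) / (2 * real l + 1)) = 0"
          by (rule sum.neutral) (simp add: n0)
        then obtain p q r where "reduced N c s U (shifted N G c s U u v) p q r 0"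
          using reduced_shifted_first[OF U v cs, of G] unfolding u_def by metis
        from step[OF step[OF this, of a], of "- a"]
        obtain r' where "reduced N c s U (fold (shifted N G c s U) ?ls v) 0 0 r' 0"
          using True T0 b2 by (auto simp: algebra_simps)
        then show ?thesis by (rule reduced_zero[OF _ cs]) (simp add: n0)
      qed
      then show ?thesis
        unfolding c_def[symmetric] s_def[symmetric] by (intro diag[of ?ls]) (use ab in auto)
    qed
  qed
  then show ?thesis by (simp add: globally_hyperbolic_on_def)
qed

end
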